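(* Let $X\subset\mathbb{C}$ be a perfect, compact set whose boundary is given by a finite union $\Gamma$ of piecewise smooth Jordan curves, and such that $\Gamma$ has winding number $1$ about each point of $X\setminus\Gamma$ and $0$ about each point of the complement of $X$. Let $\phi\in D^\infty(X)$ with $\phi:X\to X$. Suppose that $|\phi'(z)|\le1$ for all $z\in\phi^{-1}(\Gamma)$. Then there exists a nonanalytic algebra sequence $(M_n)_{n\ge0}$ such that $\phi$ induces an endomorphism of $D(X,M)$.
   Context: For a perfect compact set $X\subset\mathbb{C}$, a function $f:X\to\mathbb{C}$ is complex-differentiable at $a\in X$ if $f'(a)=\lim_{z\to a,\ z\in X}\frac{f(z)-f(a)}{z-a}$ exists; higher derivatives $f^{(n)}$ are defined by iteration, and $D^\infty(X)$ is the set of infinitely complex-differentiable functions on $X$. $\|\cdot\|_\infty$ is the sup norm over $X$. An algebra sequence (weight sequence) is a sequence $(M_n)_{n\ge0}$ of positive numbers with $M_0=1$ and $\binom{m+n}{n}\le\frac{M_{m+n}}{M_mM_n}$ for all $m,n\ge0$. It is nonanalytic if $\lim_{n\to\infty}(n!/M_n)^{1/n}=0$. Define $D(X,M)=\{f\in D^\infty(X):\|f\|_{D(X,M)}=\sum_{n=0}^\infty\frac{\|f^{(n)}\|_\infty}{M_n}<\infty\}$, a commutative normed algebra under pointwise operations (not necessarily complete). A map $\phi:X\to X$ induces an endomorphism of $D(X,M)$ if $f\circ\phi\in D(X,M)$ for all $f\in D(X,M)$. The winding number of $\Gamma$ about a point is the total winding number of the (oriented) curves making up $\Gamma$. *)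

theory Defs
  imports "HOL-Complex_Analysis.Complex_Analysis"
begin

(* A function X \<rightarrow> \<complex> is represented by a total function; everything below depends only on
   its values on X. *)

definition perfect_compact :: "complex set \<Rightarrow> bool" where
  "perfect_compact X \<longleftrightarrow> compact X \<and> (\<forall>a\<in>X. a islimpt X)"

(* The derivative along X: the limit of the difference quotients is taken over z \<in> X only. It is
   unique at limit points a of X. Unlike deriv, it does not refer to values of f outside X. *)
definition deriv_on :: "complex set \<Rightarrow> (complex \<Rightarrow> complex) \<Rightarrow> complex \<Rightarrow> complex" where
  "deriv_on X f a = (THE D. (f has_field_derivative D) (at a within X))"

abbreviation higher_deriv_on ::
    "nat \<Rightarrow> complex set \<Rightarrow> (complex \<Rightarrow> complex) \<Rightarrow> complex \<Rightarrow> complex" where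
  "higher_deriv_on n X f \<equiv> (deriv_on X ^^ n) f"

definition D_infinity :: "complex set \<Rightarrow> (complex \<Rightarrow> complex) set" where
  "D_infinity X = {f. \<forall>n. \<forall>a\<in>X. higher_deriv_on n X f field_differentiable (at a within X)}"

definition sup_norm_on :: "complex set \<Rightarrow> (complex \<Rightarrow> complex) \<Rightarrow> real" where
  "sup_norm_on X f = (SUP z\<in>X. norm (f z))"

definition algebra_sequence :: "(nat \<Rightarrow> real) \<Rightarrow> bool" where
  "algebra_sequence M \<longleftrightarrow> (\<forall>n. M n > 0) \<and> M 0 = 1 \<and>
     (\<forall>m n. real ((m + n) choose n) \<le> M (m + n) / (M m * M n))"

definition nonanalytic :: "(nat \<Rightarrow> real) \<Rightarrow> bool" where
  "nonanalytic M \<longleftrightarrow> (\<lambda>n. root n (fact n / M n)) \<longlonglongrightarrow> 0"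

(* On nonempty compact X each derivative of f \<in> D_infinity X is bounded, so the suprema are genuine; the
   terms are nonnegative, so summability says that the norm of f in D(X,M) is finite. *)
definition D_algebra :: "complex set \<Rightarrow> (nat \<Rightarrow> real) \<Rightarrow> (complex \<Rightarrow> complex) set" where
  "D_algebra X M =
     {f \<in> D_infinity X. summable (\<lambda>n. sup_norm_on X (higher_deriv_on n X f) / M n)}"

definition induces_endomorphism ::
    "complex set \<Rightarrow> (nat \<Rightarrow> real) \<Rightarrow> (complex \<Rightarrow> complex) \<Rightarrow> bool" where
  "induces_endomorphism X M \<phi> \<longleftrightarrow> (\<forall>f\<in>D_algebra X M. f \<circ> \<phi> \<in> D_algebra X M)"

(* valid_path means piecewise continuously differentiable; the parametrisation carries the
   orientation. *)
definition piecewise_smooth_Jordan_curve :: "(real \<Rightarrow> complex) \<Rightarrow> bool" where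
  "piecewise_smooth_Jordan_curve \<gamma> \<longleftrightarrow>
     valid_path \<gamma> \<and> simple_path \<gamma> \<and> pathfinish \<gamma> = pathstart \<gamma>"

end

theory Submission
  imports Defs
begin

text \<open>For \<open>f\<close> infinitely differentiable along \<open>X\<close>, the \<open>n\<close>-th derivative of \<open>f \<circ> \<phi>\<close> at \<open>z\<close> is the
  sum over \<open>k \<le> n\<close> of the \<open>k\<close>-th derivatives of \<open>f\<close> at \<open>\<phi> z\<close>, with coefficients that depend only on
  \<open>\<phi>\<close> (\<open>higher_deriv_on_compose\<close>). The coefficients with \<open>k < n\<close> are bounded on \<open>X\<close> by a number
  \<open>b n\<close>, so these terms are negligible once \<open>M n\<close> is much larger than \<open>b n * M k\<close> for all \<open>k < n\<close>.

  There remains the term with \<open>k = n\<close>, whose coefficient is the \<open>n\<close>-th power of the derivative of \<open>\<phi>\<close>.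
  Where that derivative has modulus at most \<open>1 + 1 / (n + 1)\<close>, its \<open>n\<close>-th power has modulus at most
  \<open>exp 1\<close>, and the \<open>n\<close>-th derivative of \<open>f\<close> contributes a summable term by assumption. The rest of
  \<open>X\<close> is contained in the compact set where the modulus is at least \<open>1 + 1 / (n + 1)\<close>. By hypothesis
  \<open>\<phi>\<close> maps this set into the interior of \<open>X\<close>, so its image has a distance at least \<open>r n > 0\<close> from
  the boundary (\<open>large_deriv_maps_inside\<close>), and Cauchy's estimate bounds the \<open>n\<close>-th derivative of
  \<open>f\<close> there by \<open>fact n / r n ^ n\<close> times the supremum of \<open>f\<close>. Again this is negligible if \<open>M n\<close> is
  large.

  Since the radii and the coefficients do not depend on \<open>f\<close>, it suffices to have algebra sequences
  that are nonanalytic and grow as fast as required (\<open>rapid_nonanalytic_algebra_sequence\<close>).\<close>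

section \<open>Differentiation along a perfect set\<close>

lemma deriv_on_eqI:
  assumes "a islimpt X" and "(f has_field_derivative D) (at a within X)"
  shows "deriv_on X f a = D"
proof -
  have "at a within X \<noteq> bot"
    using assms(1) by (simp add: trivial_limit_within)
  then have "E = D" if "(f has_field_derivative E) (at a within X)" for E
    using that assms(2) unfolding has_field_derivative_iff by (blast intro: tendsto_unique)
  then show ?thesis
    unfolding deriv_on_def using assms(2) by blast
qed

lemma has_deriv_on:
  assumes "a islimpt X" and "f field_differentiable (at a within X)"
  shows "(f has_field_derivative deriv_on X f a) (at a within X)"
  using assms deriv_on_eqI unfolding field_differentiable_def by metis

lemma deriv_on_cong:
  assumes "\<And>z. z \<in> X \<Longrightarrow> f z = g z" and "a \<in> X"
  shows "deriv_on X f a = deriv_on X g a"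
proof -
  have "(f has_field_derivative D) (at a within X) = (g has_field_derivative D) (at a within X)" for D
    using assms by (intro has_field_derivative_cong_eventually)
      (auto simp: eventually_at_filter)
  then show ?thesis
    by (simp add: deriv_on_def)
qed

lemma field_differentiable_on_cong:
  assumes "\<And>z. z \<in> X \<Longrightarrow> f z = g z" and "a \<in> X"
    and "f field_differentiable (at a within X)"
  shows "g field_differentiable (at a within X)"
  using assms field_differentiable_transform_within[of 1 a X f g] by simp

text \<open>\<open>cdiff_on n X f\<close>: the function \<open>f\<close> is \<open>n\<close> times complex-differentiable along \<open>X\<close>. Peeling off
  the innermost derivative makes the product rule usable in inductions on \<open>n\<close>.\<close>

primrec cdiff_on :: "nat \<Rightarrow> complex set \<Rightarrow> (complex \<Rightarrow> complex) \<Rightarrow> bool" where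
  "cdiff_on 0 X f \<longleftrightarrow> True"
| "cdiff_on (Suc n) X f \<longleftrightarrow>
     (\<forall>a\<in>X. f field_differentiable (at a within X)) \<and> cdiff_on n X (deriv_on X f)"

lemma cdiff_on_iff:
  "cdiff_on n X f \<longleftrightarrow>
     (\<forall>k<n. \<forall>a\<in>X. higher_deriv_on k X f field_differentiable (at a within X))"
  by (induction n arbitrary: f) (simp_all add: All_less_Suc2 funpow_Suc_right del: funpow.simps(2))

lemma D_infinity_iff: "f \<in> D_infinity X \<longleftrightarrow> (\<forall>n. cdiff_on n X f)"
  unfolding D_infinity_def cdiff_on_iff by blast

lemma cdiff_on_SucD: "cdiff_on (Suc n) X f \<Longrightarrow> cdiff_on n X f"
  by (simp add: cdiff_on_iff)

lemma cdiff_on_cong: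
  assumes "\<And>z. z \<in> X \<Longrightarrow> f z = g z" and "cdiff_on n X f"
  shows "cdiff_on n X g"
  using assms
proof (induction n arbitrary: f g)
  case (Suc n)
  show ?case
    using Suc.IH[of "deriv_on X f" "deriv_on X g"] Suc.prems
      field_differentiable_on_cong[of X f g] deriv_on_cong[of X f g] by simp
qed simp

lemma D_infinity_field_differentiable:
  assumes "f \<in> D_infinity X" and "a \<in> X"
  shows "higher_deriv_on n X f field_differentiable (at a within X)"
  using assms by (auto simp: D_infinity_def)

lemma D_infinity_deriv_on:
  assumes "f \<in> D_infinity X"
  shows "deriv_on X f \<in> D_infinity X"
  using assms unfolding D_infinity_iff by (metis cdiff_on.simps(2))

lemma D_infinity_continuous_on:
  assumes "f \<in> D_infinity X"
  shows "continuous_on X (higher_deriv_on n X f)"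
  using D_infinity_field_differentiable[OF assms]
  by (auto simp: continuous_on_eq_continuous_within
      intro: field_differentiable_imp_continuous_at)

context
  fixes X :: "complex set"
  assumes perfect: "\<And>a. a \<in> X \<Longrightarrow> a islimpt X"
begin

lemma cdiff_on_const: "cdiff_on n X (\<lambda>z. c)"
proof (induction n arbitrary: c)
  case (Suc n)
  have "deriv_on X (\<lambda>z. c) a = 0" if "a \<in> X" for a
    using perfect[OF that] by (intro deriv_on_eqI) auto
  then show ?case
    using cdiff_on_cong[OF _ Suc.IH[of 0], of "deriv_on X (\<lambda>z. c)"] by simp
qed simp

lemma cdiff_on_add:
  assumes "cdiff_on n X f" and "cdiff_on n X g"
  shows "cdiff_on n X (\<lambda>z. f z + g z)"
  using assms
proof (induction n arbitrary: f g)
  case (Suc n)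
  have "deriv_on X (\<lambda>z. f z + g z) a = deriv_on X f a + deriv_on X g a" if "a \<in> X" for a
    using that perfect[OF that] Suc.prems
    by (auto intro!: deriv_on_eqI derivative_eq_intros has_deriv_on)
  then show ?case
    using cdiff_on_cong[OF _ Suc.IH[of "deriv_on X f" "deriv_on X g"],
        of "deriv_on X (\<lambda>z. f z + g z)"] Suc.prems
    by (simp add: field_differentiable_add)
qed simp

lemma cdiff_on_mult:
  assumes "cdiff_on n X f" and "cdiff_on n X g"
  shows "cdiff_on n X (\<lambda>z. f z * g z)"
  using assms
proof (induction n arbitrary: f g)
  case (Suc n)
  have "deriv_on X (\<lambda>z. f z * g z) a = f a * deriv_on X g a + deriv_on X f a * g a"
    if "a \<in> X" for a
    using that perfect[OF that] Suc.prems
    by (intro deriv_on_eqI DERIV_mult' has_deriv_on) auto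
  moreover have "cdiff_on n X (\<lambda>z. f z * deriv_on X g z + deriv_on X f z * g z)"
    using Suc.prems Suc.prems[THEN cdiff_on_SucD] by (intro cdiff_on_add Suc.IH) simp_all
  ultimately show ?case
    using cdiff_on_cong[of X "\<lambda>z. f z * deriv_on X g z + deriv_on X f z * g z"] Suc.prems
    by (simp add: field_differentiable_mult)
qed simp

lemma D_infinity_const: "(\<lambda>z. c) \<in> D_infinity X"
  by (simp add: D_infinity_iff cdiff_on_const)

lemma D_infinity_add:
  "f \<in> D_infinity X \<Longrightarrow> g \<in> D_infinity X \<Longrightarrow> (\<lambda>z. f z + g z) \<in> D_infinity X"
  by (simp add: D_infinity_iff cdiff_on_add)

lemma D_infinity_mult:
  "f \<in> D_infinity X \<Longrightarrow> g \<in> D_infinity X \<Longrightarrow> (\<lambda>z. f z * g z) \<in> D_infinity X"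
  by (simp add: D_infinity_iff cdiff_on_mult)

lemma has_higher_deriv_on:
  assumes "f \<in> D_infinity X" and "a \<in> X"
  shows "(higher_deriv_on n X f has_field_derivative higher_deriv_on (Suc n) X f a) (at a within X)"
  using has_deriv_on[OF perfect[OF assms(2)] D_infinity_field_differentiable[OF assms]] by simp

end

section \<open>The chain rule for higher derivatives\<close>

text \<open>\<open>chain_coeff X \<phi> n k\<close> is the coefficient of the \<open>k\<close>-th derivative of \<open>f\<close>, taken at \<open>\<phi> z\<close>, in
  the \<open>n\<close>-th derivative of \<open>f \<circ> \<phi>\<close>: the value of the partial Bell polynomial with indices \<open>n\<close> and \<open>k\<close>
  at the derivatives of \<open>\<phi>\<close>. The recursion is what one more differentiation produces; the explicit
  formula of Faa di Bruno is not needed.\<close>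

primrec chain_coeff ::
    "complex set \<Rightarrow> (complex \<Rightarrow> complex) \<Rightarrow> nat \<Rightarrow> nat \<Rightarrow> complex \<Rightarrow> complex" where
  "chain_coeff X \<phi> 0 k = (\<lambda>z. if k = 0 then 1 else 0)"
| "chain_coeff X \<phi> (Suc n) k = (\<lambda>z. deriv_on X (chain_coeff X \<phi> n k) z +
     (if k = 0 then 0 else chain_coeff X \<phi> n (k - 1) z) * deriv_on X \<phi> z)"

lemma chain_coeff_in_D_infinity:
  assumes perfect: "\<And>a. a \<in> X \<Longrightarrow> a islimpt X" and \<phi>: "\<phi> \<in> D_infinity X"
  shows "chain_coeff X \<phi> n k \<in> D_infinity X"
proof (induction n arbitrary: k)
  case 0
  show ?case using D_infinity_const[OF perfect] by simp
next
  case (Suc n)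
  have "(\<lambda>z. if k = 0 then 0 else chain_coeff X \<phi> n (k - 1) z) \<in> D_infinity X"
    using Suc.IH D_infinity_const[OF perfect, of 0] by (cases "k = 0") simp_all
  then show ?case
    unfolding chain_coeff.simps
    by (intro D_infinity_add D_infinity_mult D_infinity_deriv_on Suc.IH \<phi> perfect)
qed

lemma chain_coeff_eq_0:
  assumes perfect: "\<And>a. a \<in> X \<Longrightarrow> a islimpt X" and "n < k" and "z \<in> X"
  shows "chain_coeff X \<phi> n k z = 0"
  using assms(2,3)
proof (induction n arbitrary: k z)
  case (Suc n)
  have "deriv_on X (chain_coeff X \<phi> n k) z = deriv_on X (\<lambda>z. 0) z"
    using Suc by (intro deriv_on_cong) auto
  also have "\<dots> = 0"
    using perfect[OF \<open>z \<in> X\<close>] by (intro deriv_on_eqI) auto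
  finally show ?case
    using Suc by simp
qed simp

lemma chain_coeff_diag:
  assumes perfect: "\<And>a. a \<in> X \<Longrightarrow> a islimpt X" and "z \<in> X"
  shows "chain_coeff X \<phi> n n z = deriv_on X \<phi> z ^ n"
proof (induction n)
  case (Suc n)
  have "deriv_on X (chain_coeff X \<phi> n (Suc n)) z = deriv_on X (\<lambda>z. 0) z"
    using assms chain_coeff_eq_0[OF perfect] by (intro deriv_on_cong) auto
  also have "\<dots> = 0"
    using perfect[OF \<open>z \<in> X\<close>] by (intro deriv_on_eqI) auto
  finally show ?case
    using Suc by simp
qed simp

lemma has_deriv_on_chain_sum:
  assumes perfect: "\<And>a. a \<in> X \<Longrightarrow> a islimpt X"
    and \<phi>: "\<phi> \<in> D_infinity X" and \<phi>X: "\<phi> \<in> X \<rightarrow> X" and f: "f \<in> D_infinity X" and z: "z \<in> X"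
  shows "((\<lambda>z. \<Sum>k\<le>n. higher_deriv_on k X f (\<phi> z) * chain_coeff X \<phi> n k z) has_field_derivative
      (\<Sum>k\<le>Suc n. higher_deriv_on k X f (\<phi> z) * chain_coeff X \<phi> (Suc n) k z)) (at z within X)"
proof -
  let ?F = "\<lambda>k. higher_deriv_on k X f" and ?B = "chain_coeff X \<phi>"
  have d\<phi>: "(\<phi> has_field_derivative deriv_on X \<phi> z) (at z within X)"
    using has_higher_deriv_on[OF perfect \<phi> z, of 0] by simp
  have dF: "((\<lambda>z. ?F k (\<phi> z)) has_field_derivative ?F (Suc k) (\<phi> z) * deriv_on X \<phi> z)
      (at z within X)" for k
  proof -
    have "(?F k has_field_derivative ?F (Suc k) (\<phi> z)) (at (\<phi> z) within \<phi> ` X)"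
      using has_higher_deriv_on[OF perfect f, of "\<phi> z" k] \<phi>X z
      by (blast intro: DERIV_subset)
    from DERIV_image_chain[OF this d\<phi>] show ?thesis
      by (simp add: o_def)
  qed
  have dB: "(?B n k has_field_derivative deriv_on X (?B n k) z) (at z within X)" for k
    using has_higher_deriv_on[OF perfect chain_coeff_in_D_infinity[OF perfect \<phi>] z, of 0] by simp
  have "((\<lambda>z. \<Sum>k\<le>n. ?F k (\<phi> z) * ?B n k z) has_field_derivative
      (\<Sum>k\<le>n. ?F k (\<phi> z) * deriv_on X (?B n k) z + ?F (Suc k) (\<phi> z) * deriv_on X \<phi> z * ?B n k z))
      (at z within X)"
    by (intro DERIV_sum DERIV_mult' dF dB)
  moreover have "(\<Sum>k\<le>n. ?F k (\<phi> z) * deriv_on X (?B n k) z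
        + ?F (Suc k) (\<phi> z) * deriv_on X \<phi> z * ?B n k z)
      = (\<Sum>k\<le>Suc n. ?F k (\<phi> z) * ?B (Suc n) k z)"
  proof -
    have "deriv_on X (?B n (Suc n)) z = deriv_on X (\<lambda>z. 0) z"
      using z chain_coeff_eq_0[OF perfect] by (intro deriv_on_cong) auto
    also have "\<dots> = 0"
      using perfect[OF z] by (intro deriv_on_eqI) auto
    finally have "(\<Sum>k\<le>n. ?F k (\<phi> z) * deriv_on X (?B n k) z)
        = (\<Sum>k\<le>Suc n. ?F k (\<phi> z) * deriv_on X (?B n k) z)"
      by simp
    moreover have "(\<Sum>k\<le>n. ?F (Suc k) (\<phi> z) * deriv_on X \<phi> z * ?B n k z)
        = (\<Sum>k\<le>Suc n. ?F k (\<phi> z) * ((if k = 0 then 0 else ?B n (k - 1) z) * deriv_on X \<phi> z))"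
      by (subst sum.atMost_Suc_shift) (simp add: mult_ac)
    ultimately show ?thesis
      by (simp only: sum.distrib chain_coeff.simps distrib_left)
  qed
  ultimately show ?thesis by metis
qed

lemma higher_deriv_on_compose:
  assumes perfect: "\<And>a. a \<in> X \<Longrightarrow> a islimpt X"
    and \<phi>: "\<phi> \<in> D_infinity X" and \<phi>X: "\<phi> \<in> X \<rightarrow> X" and f: "f \<in> D_infinity X" and z: "z \<in> X"
  shows "higher_deriv_on n X (f \<circ> \<phi>) z =
     (\<Sum>k\<le>n. higher_deriv_on k X f (\<phi> z) * chain_coeff X \<phi> n k z)"
  using z
proof (induction n arbitrary: z)
  case (Suc n)
  show ?case
    using deriv_on_cong[OF Suc.IH Suc.prems]
      deriv_on_eqI[OF perfect[OF Suc.prems] has_deriv_on_chain_sum[OF perfect \<phi> \<phi>X f Suc.prems]]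
    by simp
qed simp

lemma D_infinity_compose:
  assumes perfect: "\<And>a. a \<in> X \<Longrightarrow> a islimpt X"
    and \<phi>: "\<phi> \<in> D_infinity X" and \<phi>X: "\<phi> \<in> X \<rightarrow> X" and f: "f \<in> D_infinity X"
  shows "f \<circ> \<phi> \<in> D_infinity X"
  unfolding D_infinity_def
proof (safe)
  fix n a assume a: "a \<in> X"
  have "(\<lambda>z. \<Sum>k\<le>n. higher_deriv_on k X f (\<phi> z) * chain_coeff X \<phi> n k z)
      field_differentiable (at a within X)"
    using has_deriv_on_chain_sum[OF assms a] field_differentiable_def by blast
  then show "higher_deriv_on n X (f \<circ> \<phi>) field_differentiable (at a within X)"
    by (rule field_differentiable_on_cong[rotated 2])
      (simp_all add: a higher_deriv_on_compose[OF assms])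
qed

section \<open>Estimates for derivatives\<close>

lemma norm_le_sup_norm_on:
  assumes "compact X" and "continuous_on X f" and "z \<in> X"
  shows "norm (f z) \<le> sup_norm_on X f"
proof -
  have "bdd_above ((\<lambda>z. norm (f z)) ` X)"
    using assms by (intro bounded_imp_bdd_above compact_imp_bounded compact_continuous_image
        continuous_intros)
  then show ?thesis
    unfolding sup_norm_on_def using assms(3) by (rule cSUP_upper2) auto
qed

lemma sup_norm_on_le:
  assumes "X \<noteq> {}" and "\<And>z. z \<in> X \<Longrightarrow> norm (f z) \<le> c"
  shows "sup_norm_on X f \<le> c"
  unfolding sup_norm_on_def using assms by (rule cSUP_least)

lemma higher_deriv_on_interior:
  assumes f: "f \<in> D_infinity X" and "z \<in> interior X"
  shows "higher_deriv_on n X f z = (deriv ^^ n) f z"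
  using assms(2)
proof (induction n arbitrary: z)
  case (Suc n)
  have "z islimpt X" "z \<in> X" "at z within X = at z"
    using Suc.prems interior_subset[of X] by (auto intro: interior_limit_point at_within_interior)
  then have "deriv_on X (higher_deriv_on n X f) z = deriv (higher_deriv_on n X f) z"
    using has_deriv_on[OF _ D_infinity_field_differentiable[OF f], of z n]
    by (metis DERIV_imp_deriv)
  also have "\<dots> = deriv ((deriv ^^ n) f) z"
    using Suc eventually_nhds_in_open[of "interior X" z]
    by (intro deriv_cong_ev) (auto elim!: eventually_mono)
  finally show ?case by simp
qed simp

lemma Cauchy_estimate_on:
  assumes "compact X" and f: "f \<in> D_infinity X" and "0 < r" and sub: "cball w r \<subseteq> X"
  shows "norm (higher_deriv_on n X f w) \<le> fact n * sup_norm_on X f / r ^ n"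
proof -
  have cont: "continuous_on X f"
    using D_infinity_continuous_on[OF f, of 0] by simp
  have ball: "ball w r \<subseteq> interior X"
    using sub ball_subset_cball by (intro interior_maximal) auto
  have "f holomorphic_on ball w r"
    unfolding holomorphic_on_def
  proof
    fix x assume "x \<in> ball w r"
    moreover have "ball w r \<subseteq> X"
      using sub ball_subset_cball by blast
    ultimately show "f field_differentiable (at x within ball w r)"
      using D_infinity_field_differentiable[OF f, of x 0]
        field_differentiable_within_subset[of f x X "ball w r"] by (simp add: subset_iff)
  qed
  then have "norm ((deriv ^^ n) f w) \<le> fact n * sup_norm_on X f / r ^ n"
    using assms(3) cont sub norm_le_sup_norm_on[OF assms(1) cont]
    by (intro Cauchy_inequality) (auto intro: continuous_on_subset simp: dist_norm)
  then show ?thesis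
    using higher_deriv_on_interior[OF f, of w n] ball \<open>0 < r\<close> by (simp add: subset_iff)
qed

text \<open>This is the only place where the bound on the derivative over the preimage of the boundary
  enters: the part of \<open>X\<close> where the derivative has modulus at least \<open>1 + \<epsilon>\<close> is compact and is mapped
  into the interior.\<close>

lemma large_deriv_maps_inside:
  fixes \<epsilon> :: real
  assumes "compact X" and \<phi>: "\<phi> \<in> D_infinity X" and "\<phi> \<in> X \<rightarrow> X"
    and small: "\<And>z. z \<in> X \<Longrightarrow> \<phi> z \<in> frontier X \<Longrightarrow> norm (deriv_on X \<phi> z) \<le> 1"
    and "0 < \<epsilon>"
  shows "\<exists>r>0. \<forall>z\<in>X. norm (deriv_on X \<phi> z) \<ge> 1 + \<epsilon> \<longrightarrow> cball (\<phi> z) r \<subseteq> X"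
proof -
  define K where "K = {z \<in> X. 1 + \<epsilon> \<le> norm (deriv_on X \<phi> z)}"
  have "continuous_on X \<phi>" "continuous_on X (deriv_on X \<phi>)"
    using D_infinity_continuous_on[OF \<phi>, of 0] D_infinity_continuous_on[OF \<phi>, of 1] by simp_all
  then have "closed K"
    unfolding K_def using \<open>compact X\<close>
    by (intro continuous_on_closed_Collect_le continuous_intros) (auto intro: compact_imp_closed)
  then have "compact K"
    using \<open>compact X\<close> compact_Int_closed[of X K] by (simp add: K_def Int_absorb1 Collect_subset)
  then have "compact (\<phi> ` K)"
    using \<open>continuous_on X \<phi>\<close> K_def
    by (intro compact_continuous_image) (auto intro: continuous_on_subset)
  moreover have "\<phi> ` K \<subseteq> interior X"
  proof
    fix w assume "w \<in> \<phi> ` K"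
    then obtain z where z: "z \<in> X" "1 + \<epsilon> \<le> norm (deriv_on X \<phi> z)" "w = \<phi> z"
      by (auto simp: K_def)
    then have "w \<in> X" "w \<notin> frontier X"
      using small[of z] assms(3) \<open>0 < \<epsilon>\<close> by auto
    then show "w \<in> interior X"
      using closure_subset by (auto simp: frontier_def)
  qed
  ultimately obtain r where "0 < r" "(\<Union>w\<in>\<phi> ` K. cball w r) \<subseteq> interior X"
    using compact_subset_open_imp_cball_epsilon_subset[of "\<phi> ` K" "interior X"] by auto
  then have "\<forall>z\<in>X. norm (deriv_on X \<phi> z) \<ge> 1 + \<epsilon> \<longrightarrow> cball (\<phi> z) r \<subseteq> X"
    using interior_subset[of X] unfolding K_def by fast
  with \<open>0 < r\<close> show ?thesis by blast
qed

section \<open>Rapidly growing weight sequences\<close>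

text \<open>Dividing by factorials turns the condition on an algebra sequence into supermultiplicativity,
  which partial products of an increasing sequence enjoy.\<close>

lemma rapid_nonanalytic_algebra_sequence:
  fixes c :: "nat \<Rightarrow> real"
  assumes c: "\<And>n. 0 \<le> c n"
  shows "\<exists>M. algebra_sequence M \<and> nonanalytic M \<and> (\<forall>n. \<forall>k<n. 2 ^ n * c n * M k \<le> M n)"
proof -
  define h where "h j = 2 ^ j * c j + real j ^ j + 1" for j
  define g where "g n = sum h {..n}" for n
  define a where "a n = prod g {1..n}" for n
  define M where "M n = fact n * a n" for n :: nat
  have h1: "1 \<le> h j" for j
    using c[of j] by (simp add: h_def)
  then have h0: "0 \<le> h j" for j
    using order_trans[OF zero_le_one] by blast
  have gh: "h n \<le> g n" for n
    unfolding g_def by (rule member_le_sum) (use h0 in auto)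
  have mono: "g m \<le> g n" if "m \<le> n" for m n
    unfolding g_def using that h0 by (intro sum_mono2) auto
  have g1: "1 \<le> g n" for n
    using order_trans[OF h1 gh] .
  have a_Suc: "a (Suc n) = a n * g (Suc n)" for n
    by (simp add: a_def)
  have a1: "1 \<le> a n" for n
    unfolding a_def by (rule prod_ge_1) (use g1 in auto)
  then have a0: "0 \<le> a n" for n
    using order_trans[OF zero_le_one] by blast
  have a_super: "a m * a n \<le> a (m + n)" for m n
  proof (induction n)
    case (Suc n)
    have "a m * a (Suc n) = (a m * a n) * g (Suc n)"
      by (simp add: a_Suc)
    also have "\<dots> \<le> a (m + n) * g (Suc (m + n))"
      using Suc mono[of "Suc n" "Suc (m + n)"] a1[of "m + n"] g1[of "Suc n"]
      by (intro mult_mono) auto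
    finally show ?case by (simp add: a_Suc)
  qed (simp add: a_def)
  have a_mono: "a k \<le> a n" if "k \<le> n" for k n
  proof -
    have "a k * 1 \<le> a k * a (n - k)"
      using a1[of k] a1[of "n - k"] by (intro mult_left_mono) auto
    then show ?thesis
      using a_super[of k "n - k"] that by simp
  qed
  have ga: "g n * a k \<le> a n" if "k < n" for k n
  proof -
    obtain m where n: "n = Suc m" "k \<le> m"
      using \<open>k < n\<close> by (cases n) auto
    show ?thesis
      using a_mono[OF n(2)] g1[of n] by (simp add: n(1) a_Suc mult.commute mult_left_mono)
  qed
  have "algebra_sequence M"
    unfolding algebra_sequence_def
  proof (intro conjI allI)
    show M_pos: "0 < M n" for n
      using a1[of n] by (simp add: M_def)
    show "M 0 = 1"
      by (simp add: M_def a_def)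
    show "real ((m + n) choose n) \<le> M (m + n) / (M m * M n)" for m n
    proof -
      have "real ((m + n) choose n) * (M m * M n) = fact (m + n) * (a m * a n)"
        using binomial_fact[of n "m + n", where 'a = real] by (simp add: M_def)
      also have "\<dots> \<le> M (m + n)"
        using a_super[of m n] by (simp add: M_def)
      finally show ?thesis
        using M_pos[of m] M_pos[of n] by (simp add: pos_le_divide_eq)
    qed
  qed
  moreover have "nonanalytic M"
    unfolding nonanalytic_def
  proof (rule tendsto_sandwich[OF _ _ tendsto_const lim_1_over_n])
    show "\<forall>\<^sub>F n in sequentially. 0 \<le> root n (fact n / M n)"
      using a0 by (intro always_eventually allI real_root_ge_zero) (simp add: M_def)
    show "\<forall>\<^sub>F n in sequentially. root n (fact n / M n) \<le> 1 / real n"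
      using eventually_gt_at_top[of 0]
    proof eventually_elim
      case (elim n)
      have "real n ^ n \<le> h n"
        using c[of n] by (simp add: h_def)
      also have "\<dots> \<le> g n * a 0"
        using gh by (simp add: a_def)
      also have "\<dots> \<le> a n"
        using ga elim by blast
      finally have "fact n / M n \<le> (1 / real n) ^ n"
        using elim by (simp add: M_def power_one_over frac_le)
      then have "root n (fact n / M n) \<le> root n ((1 / real n) ^ n)"
        using elim by simp
      also have "\<dots> = 1 / real n"
        using elim by (intro real_root_power_cancel) auto
      finally show ?case .
    qed
  qed
  moreover have "2 ^ n * c n * M k \<le> M n" if "k < n" for k n
  proof -
    have "0 \<le> real n ^ n"
      by simp
    then have "2 ^ n * c n \<le> g n"
      using gh[of n] unfolding h_def by linarith
    then have "(2 ^ n * c n) * a k \<le> g n * a k"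
      using a1[of k] by (intro mult_right_mono) auto
    also have "\<dots> \<le> a n"
      using ga that by blast
    finally have "fact k * ((2 ^ n * c n) * a k) \<le> fact n * a n"
      using that a1[of k] c[of n] by (intro mult_mono fact_mono) auto
    then show ?thesis
      by (simp add: M_def mult_ac)
  qed
  ultimately show ?thesis by blast
qed

section \<open>Composition operators\<close>

text \<open>The main estimate at a point. The hypotheses on \<open>b\<close>, \<open>P\<close> and \<open>r\<close> do not involve \<open>f\<close>, so a
  weight sequence chosen in terms of them serves all \<open>f\<close> at once.\<close>

lemma norm_higher_deriv_on_compose_le:
  assumes "compact X" and perfect: "\<And>a. a \<in> X \<Longrightarrow> a islimpt X"
    and \<phi>: "\<phi> \<in> D_infinity X" and \<phi>X: "\<phi> \<in> X \<rightarrow> X" and f: "f \<in> D_infinity X" and z: "z \<in> X"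
    and b: "\<And>k. k < n \<Longrightarrow> norm (chain_coeff X \<phi> n k z) \<le> b"
    and P: "norm (deriv_on X \<phi> z) \<le> P"
    and "0 < r"
    and r: "norm (deriv_on X \<phi> z) \<ge> 1 + 1 / real (Suc n) \<Longrightarrow> cball (\<phi> z) r \<subseteq> X"
  shows "norm (higher_deriv_on n X (f \<circ> \<phi>) z) \<le>
      exp 1 * sup_norm_on X (higher_deriv_on n X f) + fact n * sup_norm_on X f / r ^ n * P ^ n
      + b * (\<Sum>k<n. sup_norm_on X (higher_deriv_on k X f))"
proof -
  define F where "F k = sup_norm_on X (higher_deriv_on k X f)" for k
  have \<phi>z: "\<phi> z \<in> X"
    using \<phi>X z by blast
  have F: "norm (higher_deriv_on k X f (\<phi> z)) \<le> F k" for k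
    unfolding F_def by (intro norm_le_sup_norm_on D_infinity_continuous_on assms(1) f \<phi>z)
  have F0: "0 \<le> F k" for k
    using F norm_ge_zero order_trans by blast
  have P0: "0 \<le> P"
    using P norm_ge_zero order_trans by blast
  have Ff: "sup_norm_on X f = F 0"
    by (simp add: F_def)
  have top: "norm (higher_deriv_on n X f (\<phi> z) * chain_coeff X \<phi> n n z)
      \<le> exp 1 * F n + fact n * F 0 / r ^ n * P ^ n"
  proof (cases "norm (deriv_on X \<phi> z) \<ge> 1 + 1 / real (Suc n)")
    case True
    have "norm (higher_deriv_on n X f (\<phi> z)) * norm (deriv_on X \<phi> z) ^ n
        \<le> fact n * F 0 / r ^ n * P ^ n"
      using Cauchy_estimate_on[OF assms(1) f \<open>0 < r\<close> r[OF True], of n] P P0 F0[of 0] \<open>0 < r\<close>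
      by (intro mult_mono power_mono) (auto simp: Ff)
    then show ?thesis
      using F0[of n] chain_coeff_diag[OF perfect z, of \<phi> n]
      by (simp add: norm_mult norm_power add_increasing)
  next
    case False
    have "norm (deriv_on X \<phi> z) ^ n \<le> (1 + 1 / real (Suc n)) ^ n"
      using False by (intro power_mono) auto
    also have "\<dots> \<le> (1 + 1 / real (Suc n)) ^ Suc n"
      by (intro power_increasing) auto
    also have "\<dots> \<le> exp 1"
      by (rule exp_ge_one_plus_x_over_n_power_n) auto
    finally have "norm (higher_deriv_on n X f (\<phi> z)) * norm (deriv_on X \<phi> z) ^ n \<le> F n * exp 1"
      using F F0 by (intro mult_mono) auto
    moreover have "0 \<le> fact n * F 0 / r ^ n * P ^ n"
      using F0[of 0] P0 \<open>0 < r\<close> by simp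
    ultimately show ?thesis
      using chain_coeff_diag[OF perfect z, of \<phi> n]
      by (simp add: norm_mult norm_power mult.commute)
  qed
  have low: "norm (\<Sum>k<n. higher_deriv_on k X f (\<phi> z) * chain_coeff X \<phi> n k z) \<le> b * (\<Sum>k<n. F k)"
  proof -
    have "norm (\<Sum>k<n. higher_deriv_on k X f (\<phi> z) * chain_coeff X \<phi> n k z) \<le> (\<Sum>k<n. F k * b)"
      using F F0 b by (intro sum_norm_le) (auto simp: norm_mult intro!: mult_mono)
    then show ?thesis
      by (simp add: sum_distrib_left mult.commute)
  qed
  have "{..n} = insert n {..<n}" by auto
  then have "higher_deriv_on n X (f \<circ> \<phi>) z =
      higher_deriv_on n X f (\<phi> z) * chain_coeff X \<phi> n n z
      + (\<Sum>k<n. higher_deriv_on k X f (\<phi> z) * chain_coeff X \<phi> n k z)"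
    using higher_deriv_on_compose[OF perfect \<phi> \<phi>X f z, of n] by simp
  then show ?thesis
    using norm_triangle_mono[OF top low] by (simp add: F_def)
qed

theorem theorem3:
  fixes X \<Gamma> :: "complex set"
    and \<C> :: "(real \<Rightarrow> complex) set"
    and \<phi> :: "complex \<Rightarrow> complex"
  assumes "perfect_compact X"
    and "finite \<C>"
    and "\<And>\<gamma>. \<gamma> \<in> \<C> \<Longrightarrow> piecewise_smooth_Jordan_curve \<gamma>"
    and "\<Gamma> = (\<Union>\<gamma>\<in>\<C>. path_image \<gamma>)"
    and "frontier X = \<Gamma>"
    and "\<And>z. z \<in> X - \<Gamma> \<Longrightarrow> (\<Sum>\<gamma>\<in>\<C>. winding_number \<gamma> z) = 1"
    and "\<And>z. z \<notin> X \<Longrightarrow> (\<Sum>\<gamma>\<in>\<C>. winding_number \<gamma> z) = 0"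
    and "\<phi> \<in> D_infinity X"
    and "\<phi> \<in> X \<rightarrow> X"
    and "\<And>z. z \<in> X \<Longrightarrow> \<phi> z \<in> \<Gamma> \<Longrightarrow> norm (deriv_on X \<phi> z) \<le> 1"
  shows "\<exists>M. algebra_sequence M \<and> nonanalytic M \<and> induces_endomorphism X M \<phi>"
proof -
  have "compact X" and perfect: "\<And>a. a \<in> X \<Longrightarrow> a islimpt X"
    using assms(1) by (auto simp: perfect_compact_def)
  note \<phi> = \<open>\<phi> \<in> D_infinity X\<close> and \<phi>X = \<open>\<phi> \<in> X \<rightarrow> X\<close>
  have "\<exists>r>0. \<forall>z\<in>X. norm (deriv_on X \<phi> z) \<ge> 1 + 1 / real (Suc n) \<longrightarrow> cball (\<phi> z) r \<subseteq> X" for n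
    using assms(5,10) by (intro large_deriv_maps_inside \<open>compact X\<close> \<phi> \<phi>X) auto
  then obtain r where r0: "\<And>n. 0 < r n"
    and r: "\<And>n z. z \<in> X \<Longrightarrow> norm (deriv_on X \<phi> z) \<ge> 1 + 1 / real (Suc n) \<Longrightarrow> cball (\<phi> z) (r n) \<subseteq> X"
    by metis
  define P where "P = \<bar>sup_norm_on X (deriv_on X \<phi>)\<bar>"
  have P: "norm (deriv_on X \<phi> z) \<le> P" if "z \<in> X" for z
    using norm_le_sup_norm_on[OF \<open>compact X\<close> D_infinity_continuous_on[OF \<phi>, of 1] that]
    by (simp add: P_def)
  define b where "b n = (\<Sum>k<n. \<bar>sup_norm_on X (chain_coeff X \<phi> n k)\<bar>)" for n
  have b: "norm (chain_coeff X \<phi> n k z) \<le> b n" if "z \<in> X" "k < n" for n k z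
  proof -
    have "norm (chain_coeff X \<phi> n k z) \<le> \<bar>sup_norm_on X (chain_coeff X \<phi> n k)\<bar>"
      using norm_le_sup_norm_on[OF \<open>compact X\<close> _ \<open>z \<in> X\<close>, of "chain_coeff X \<phi> n k"]
        D_infinity_continuous_on[OF chain_coeff_in_D_infinity[OF perfect \<phi>], of 0 n k] by simp
    also have "\<dots> \<le> b n"
      unfolding b_def using \<open>k < n\<close> by (intro member_le_sum) auto
    finally show ?thesis .
  qed
  have b0: "0 \<le> b n" for n
    by (simp add: b_def sum_nonneg)
  define d where "d n = fact n / r n ^ n * P ^ n" for n
  have d0: "0 \<le> d n" for n
    using r0[of n] by (simp add: d_def P_def)
  obtain M where M: "algebra_sequence M" "nonanalytic M"
    and fast: "\<And>n k. k < n \<Longrightarrow> 2 ^ n * (b n + d n) * M k \<le> M n"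
    using rapid_nonanalytic_algebra_sequence[of "\<lambda>n. b n + d n"] b0 d0 by auto
  have M0: "0 < M n" "M 0 = 1" for n
    using M(1) by (auto simp: algebra_sequence_def)
  have "induces_endomorphism X M \<phi>"
    unfolding induces_endomorphism_def
  proof
    fix f assume "f \<in> D_algebra X M"
    then have f: "f \<in> D_infinity X"
      and sf: "summable (\<lambda>n. sup_norm_on X (higher_deriv_on n X f) / M n)"
      by (auto simp: D_algebra_def)
    have "summable (\<lambda>n. sup_norm_on X (higher_deriv_on n X (f \<circ> \<phi>)) / M n)"
    proof (cases "X = {}")
      case True
      \<comment> \<open>All suprema are over the empty set, hence equal.\<close>
      then show ?thesis
        using sf by (simp add: sup_norm_on_def)
    next
      case False
      define F where "F k = sup_norm_on X (higher_deriv_on k X f)" for k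
      define G where "G n = sup_norm_on X (higher_deriv_on n X (f \<circ> \<phi>))" for n
      have nonneg: "0 \<le> sup_norm_on X (higher_deriv_on k X g)" if "g \<in> D_infinity X" for g k
      proof -
        obtain z where "z \<in> X" using False by blast
        show ?thesis
          using norm_le_sup_norm_on[OF \<open>compact X\<close> D_infinity_continuous_on[OF that] \<open>z \<in> X\<close>]
            norm_ge_zero order_trans by blast
      qed
      have F0: "0 \<le> F k" for k
        unfolding F_def using f by (rule nonneg)
      have G0: "0 \<le> G k" for k
        unfolding G_def using D_infinity_compose[OF perfect \<phi> \<phi>X f] by (rule nonneg)
      define S where "S = (\<Sum>n. F n / M n)"
      have sF: "summable (\<lambda>n. F n / M n)"
        using sf by (simp add: F_def)
      have partial: "(\<Sum>k<n. F k / M k) \<le> S" for n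
        unfolding S_def using sF F0 M0(1) by (intro sum_le_suminf divide_nonneg_pos) auto
      have GF: "G n \<le> exp 1 * F n + d n * F 0 + b n * (\<Sum>k<n. F k)" for n
        unfolding G_def
      proof (rule sup_norm_on_le[OF False])
        fix z assume z: "z \<in> X"
        show "norm (higher_deriv_on n X (f \<circ> \<phi>) z)
            \<le> exp 1 * F n + d n * F 0 + b n * (\<Sum>k<n. F k)"
          using norm_higher_deriv_on_compose_le[OF \<open>compact X\<close> perfect \<phi> \<phi>X f z b[OF z] P[OF z]
              r0[of n] r[OF z, of n]]
          by (simp add: F_def d_def mult_ac)
      qed
      have GM: "G n / M n \<le> exp 1 * (F n / M n) + (F 0 + S) * (1 / 2) ^ n" if "0 < n" for n
      proof -
        \<comment> \<open>The growth of \<open>M\<close> absorbs every coefficient up to \<open>b n + d n\<close> and leaves a factor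
          \<open>(1 / 2) ^ n\<close>, which makes the terms with \<open>k < n\<close> summable over \<open>n\<close>.\<close>
        have small: "x * F k / M n \<le> F k / M k * (1 / 2) ^ n"
          if "k < n" "0 \<le> x" "x \<le> b n + d n" for k x
        proof -
          have "2 ^ n * x * M k \<le> 2 ^ n * (b n + d n) * M k"
            using that M0(1)[of k] by (intro mult_right_mono mult_left_mono) auto
          then have "2 ^ n * x * M k \<le> M n"
            using fast[OF \<open>k < n\<close>] by linarith
          then have "x / M n \<le> 1 / (2 ^ n * M k)"
            using M0(1)[of k] M0(1)[of n] by (simp add: field_simps)
          then have "x / M n * F k \<le> 1 / (2 ^ n * M k) * F k"
            using F0 by (intro mult_right_mono)
          then show ?thesis
            by (simp add: power_one_over mult_ac)
        qed
        have "d n * F 0 / M n \<le> F 0 * (1 / 2) ^ n"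
          using small[OF \<open>0 < n\<close> d0[of n]] b0[of n] M0(2) by simp
        moreover have "b n * (\<Sum>k<n. F k) / M n \<le> S * (1 / 2) ^ n"
        proof -
          have "b n * (\<Sum>k<n. F k) / M n = (\<Sum>k<n. b n * F k / M n)"
            by (simp add: sum_distrib_left sum_divide_distrib)
          also have "\<dots> \<le> (\<Sum>k<n. F k / M k * (1 / 2) ^ n)"
            using small b0 d0 by (intro sum_mono) auto
          also have "\<dots> = (\<Sum>k<n. F k / M k) * (1 / 2) ^ n"
            by (simp add: sum_distrib_right)
          also have "\<dots> \<le> S * (1 / 2) ^ n"
            using partial by (intro mult_right_mono) auto
          finally show ?thesis .
        qed
        moreover have "G n / M n \<le> (exp 1 * F n + d n * F 0 + b n * (\<Sum>k<n. F k)) / M n"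
          using GF M0(1)[of n] by (intro divide_right_mono) auto
        ultimately show ?thesis
          by (simp add: add_divide_distrib distrib_right)
      qed
      have "summable (\<lambda>n. exp 1 * (F n / M n) + (F 0 + S) * (1 / 2) ^ n)"
        by (intro summable_add summable_mult sF) simp_all
      then have "summable (\<lambda>n. G n / M n)"
        using GM G0 M0 by (intro summable_comparison_test[where f = "\<lambda>n. G n / M n"])
          (auto intro!: exI[of _ 1] simp: abs_of_nonneg less_imp_le)
      then show ?thesis
        by (simp add: G_def)
    qed
    then show "f \<circ> \<phi> \<in> D_algebra X M"
      using D_infinity_compose[OF perfect \<phi> \<phi>X f] by (simp add: D_algebra_def)
  qed
  with M show ?thesis by blast
qed

end
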